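(* Let $A$ be an algebra over a field $F$ with $\mathrm{char}(F)\neq 2$, and let $\lambda,\delta\in F\setminus\{0,1\}$. (i) If $a\in A$ is a left axis of type $\lambda$, then the left decomposition $x=x_1+x_0+x_\lambda$ of $x\in A$ with respect to $a$ (with $x_\rho\in A_\rho(L_a)$) is given by - $x_1=\frac{1}{1-\lambda}\,L_a(L_a-\lambda)x=\alpha_x a$ with $\alpha_x\in F$, - $x_0=\frac1\lambda\,(L_a-\lambda)(L_a-1)x\in A_0(L_a)$, - $x_\lambda=\frac{1}{\lambda(\lambda-1)}\,L_a(L_a-1)x\in A_\lambda(L_a)$. (ii) If $a$ is moreover a right axis of type $\delta$, then for each $\rho\in\{0,1,\lambda\}$ there is an analogous further right decomposition $x_\rho=x_{\rho,1}+x_{\rho,0}+x_{\rho,\delta}$ with respect to $a$, given by - $x_{\rho,1}=\frac{1}{1-\delta}\,R_a(R_a-\delta)x_\rho=\alpha_{x_\rho}a$ with $\alpha_{x_\rho}\in F$, - $x_{\rho,0}=\frac1\delta\,(R_a-\delta)(R_a-1)x_\rho\in A_0(R_a)$, - $x_{\rho,\delta}=\frac{1}{\delta(\delta-1)}\,R_a(R_a-1)x_\rho\in A_\delta(R_a)$. (iii) If $a$ is a left axis, then an idempotent $b\neq a$ cannot be a left eigenvector of $a$ (i.e. an eigenvector of $L_a$) unless $ab=0$. (iv) If $a$ is an axis of type $(\lambda,\delta)$, then $A$ decomposes as a direct sum $$A=(A_{1,1}\oplus A_{0,0})\oplus A_{0,\delta}\oplus A_{\lambda,0}\oplus A_{\lambda,\delta},$$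 and this is a $\mathbb Z_2\times\mathbb Z_2$-grading of $A$ with $++$-part $A_{1,1}\oplus A_{0,0}$, $+-$-part $A_{0,\delta}$, $-+$-part $A_{\lambda,0}$ and $--$-part $A_{\lambda,\delta}$. In particular $A_{0,1}=A_{\lambda,1}=A_{1,0}=A_{1,\delta}=0$. (v) If $a$ is an axis of Jordan type $(\lambda,\delta)$, then $$A=(A_{1,1}\oplus A_{0,0})\oplus A_{\lambda,\delta}$$ is a $\mathbb Z_2$-grading of $A$ with $+$-part $A_{1,1}\oplus A_{0,0}$ and $-$-part $A_{\lambda,\delta}$.
   Context: Algebras are not necessarily associative, commutative or unital. For $a\in A$ put $L_a(x)=ax$, $R_a(x)=xa$; for $X\in\{L,R\}$ let $A_\lambda(X_a)=\{v: X_a(v)=\lambda v\}$, write $A_\lambda=A_\lambda(L_a)$, and $A_{\lambda,\delta}=A_\lambda(L_a)\cap A_\delta(R_a)$. Let $a$ be an idempotent ($a^2=a$) and $\lambda,\delta\in F\setminus\{0,1\}$. $a$ is a left axis of type $\lambda$ if: (a) $A_1(L_a)=Fa$; (b) $(L_a-\lambda)(L_a-1)L_a=0$; (c) the decomposition $A=(A_0\oplus A_1)\oplus A_\lambda$ (eigenspaces of $L_a$) is a $\mathbb Z_2$-grading of $A$ with $+$-part $A_0\oplus A_1$ and $-$-part $A_\lambda$. ($A_0$ is not required to be a subalgebra.) A right axis of type $\delta$ is defined similarly using $R_a$. $a$ is an axis of type $(\lambda,\delta)$ if it is a left axis of type $\lambda$, a right axis of type $\delta$, and $L_aR_a=R_aL_a$.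 An axis $a$ of type $(\lambda,\delta)$ is of Jordan type $(\lambda,\delta)$ if $A_{\lambda,0}=A_{0,\delta}=0$. In a $\mathbb Z_2\times\mathbb Z_2$-grading the index group is $\{+,-\}\times\{+,-\}$ with componentwise multiplication. *)

theory Defs
  imports
    "HOL-Library.FuncSet"
    "HOL-Library.Set_Algebras"
    "HOL-Library.Product_Plus"
    "HOL-Library.Z2"
    "HOL-Computational_Algebra.Computational_Algebra"
begin

text \<open>
  An algebra over a field is a vector space \<open>s\<close> with a bilinear product \<open>m\<close>; no associativity,
  commutativity or unit is assumed.
\<close>

locale nonassoc_algebra = vector_space s
  for s :: "'f::field \<Rightarrow> 'a::ab_group_add \<Rightarrow> 'a" +
  fixes m :: "'a \<Rightarrow> 'a \<Rightarrow> 'a"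
  assumes linear_left: "\<And>a. Vector_Spaces.linear s s (\<lambda>x. m a x)"
    and linear_right: "\<And>a. Vector_Spaces.linear s s (\<lambda>x. m x a)"

definition Lop :: "('a \<Rightarrow> 'a \<Rightarrow> 'a) \<Rightarrow> 'a \<Rightarrow> 'a \<Rightarrow> 'a" where
  "Lop m a = (\<lambda>x. m a x)"

definition Rop :: "('a \<Rightarrow> 'a \<Rightarrow> 'a) \<Rightarrow> 'a \<Rightarrow> 'a \<Rightarrow> 'a" where
  "Rop m a = (\<lambda>x. m x a)"

text \<open>The operator \<open>T - \<mu>\<close>.\<close>

definition shift :: "('f \<Rightarrow> 'a \<Rightarrow> 'a) \<Rightarrow> ('a \<Rightarrow> 'a) \<Rightarrow> 'f \<Rightarrow> 'a::ab_group_add \<Rightarrow> 'a" where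
  "shift s T \<mu> = (\<lambda>x. T x - s \<mu> x)"

definition eigenspace :: "('f \<Rightarrow> 'a \<Rightarrow> 'a) \<Rightarrow> ('a \<Rightarrow> 'a) \<Rightarrow> 'f \<Rightarrow> 'a set" where
  "eigenspace s T \<mu> = {v. T v = s \<mu> v}"

definition is_eigenvector :: "('f \<Rightarrow> 'a \<Rightarrow> 'a) \<Rightarrow> ('a \<Rightarrow> 'a) \<Rightarrow> 'a::zero \<Rightarrow> bool" where
  "is_eigenvector s T v \<longleftrightarrow> v \<noteq> 0 \<and> (\<exists>\<mu>. v \<in> eigenspace s T \<mu>)"

text \<open>\<open>joint_eigenspace s m a (\<mu>, \<nu>)\<close> is $A_{\mu,\nu} = A_\mu(L_a) \cap A_\nu(R_a)$.\<close>

definition joint_eigenspace ::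
    "('f \<Rightarrow> 'a \<Rightarrow> 'a) \<Rightarrow> ('a \<Rightarrow> 'a \<Rightarrow> 'a) \<Rightarrow> 'a \<Rightarrow> 'f \<times> 'f \<Rightarrow> 'a set" where
  "joint_eigenspace s m a = (\<lambda>(\<mu>, \<nu>). eigenspace s (Lop m a) \<mu> \<inter> eigenspace s (Rop m a) \<nu>)"

text \<open>
  The whole space is the internal direct sum of the subspaces \<open>V i\<close>, \<open>i \<in> I\<close>: every vector is
  a sum of components \<open>f i \<in> V i\<close> for exactly one family \<open>f\<close>.
\<close>

definition is_direct_sum ::
    "('f::field \<Rightarrow> 'a::ab_group_add \<Rightarrow> 'a) \<Rightarrow> 'i set \<Rightarrow> ('i \<Rightarrow> 'a set) \<Rightarrow> bool" where
  "is_direct_sum s I V \<longleftrightarrow>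
     finite I \<and> (\<forall>i\<in>I. module.subspace s (V i)) \<and>
     bij_betw (\<lambda>f. \<Sum>i\<in>I. f i) (Pi\<^sub>E I V) UNIV"

text \<open>A grading of the algebra by a (finite, additively written) abelian group \<open>'g\<close>.\<close>

definition is_grading ::
    "('f::field \<Rightarrow> 'a::ab_group_add \<Rightarrow> 'a) \<Rightarrow> ('a \<Rightarrow> 'a \<Rightarrow> 'a) \<Rightarrow>
     ('g::ab_group_add \<Rightarrow> 'a set) \<Rightarrow> bool" where
  "is_grading s m V \<longleftrightarrow>
     is_direct_sum s UNIV V \<and>
     (\<forall>g h. \<forall>x\<in>V g. \<forall>y\<in>V h. m x y \<in> V (g + h))"

text \<open>
  The sign group \<open>{+, -}\<close> is the additive group of \<^typ>\<open>bit\<close>, with \<open>+\<close> being \<open>0\<close> and \<open>-\<close>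
  being \<open>1\<close>; the group on \<^typ>\<open>bit \<times> bit\<close> is componentwise.
\<close>

definition is_Z2_grading ::
    "('f::field \<Rightarrow> 'a::ab_group_add \<Rightarrow> 'a) \<Rightarrow> ('a \<Rightarrow> 'a \<Rightarrow> 'a) \<Rightarrow> 'a set \<Rightarrow> 'a set \<Rightarrow> bool" where
  "is_Z2_grading s m P M \<longleftrightarrow> is_grading s m (\<lambda>i::bit. if i = 0 then P else M)"

definition is_Z2xZ2_grading ::
    "('f::field \<Rightarrow> 'a::ab_group_add \<Rightarrow> 'a) \<Rightarrow> ('a \<Rightarrow> 'a \<Rightarrow> 'a) \<Rightarrow>
     'a set \<Rightarrow> 'a set \<Rightarrow> 'a set \<Rightarrow> 'a set \<Rightarrow> bool" where
  "is_Z2xZ2_grading s m PP PM MP MM \<longleftrightarrow>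
     is_grading s m (\<lambda>(i::bit, j::bit).
       if i = 0 then (if j = 0 then PP else PM) else (if j = 0 then MP else MM))"

text \<open>
  The common form of left (\<open>T = Lop m a\<close>) and right (\<open>T = Rop m a\<close>) axes. Sums of subspaces are
  the elementwise sums of \<^theory>\<open>HOL-Library.Set_Algebras\<close>; their directness is part of
  the \<^const>\<open>is_direct_sum\<close> clause.
\<close>

definition one_sided_axis ::
    "('f::field \<Rightarrow> 'a::ab_group_add \<Rightarrow> 'a) \<Rightarrow> ('a \<Rightarrow> 'a \<Rightarrow> 'a) \<Rightarrow> ('a \<Rightarrow> 'a) \<Rightarrow> 'a \<Rightarrow> 'f \<Rightarrow> bool" where
  "one_sided_axis s m T a \<mu> \<longleftrightarrow>
     m a a = a \<and> \<mu> \<notin> {0, 1} \<and>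
     eigenspace s T 1 = range (\<lambda>c. s c a) \<and>
     (\<forall>x. shift s T \<mu> (shift s T 1 (T x)) = 0) \<and>
     is_direct_sum s {0, 1, \<mu>} (eigenspace s T) \<and>
     is_Z2_grading s m (eigenspace s T 0 + eigenspace s T 1) (eigenspace s T \<mu>)"

definition left_axis ::
    "('f::field \<Rightarrow> 'a::ab_group_add \<Rightarrow> 'a) \<Rightarrow> ('a \<Rightarrow> 'a \<Rightarrow> 'a) \<Rightarrow> 'a \<Rightarrow> 'f \<Rightarrow> bool" where
  "left_axis s m a \<mu> \<longleftrightarrow> one_sided_axis s m (Lop m a) a \<mu>"

definition right_axis ::
    "('f::field \<Rightarrow> 'a::ab_group_add \<Rightarrow> 'a) \<Rightarrow> ('a \<Rightarrow> 'a \<Rightarrow> 'a) \<Rightarrow> 'a \<Rightarrow> 'f \<Rightarrow> bool" where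
  "right_axis s m a \<mu> \<longleftrightarrow> one_sided_axis s m (Rop m a) a \<mu>"

definition axis ::
    "('f::field \<Rightarrow> 'a::ab_group_add \<Rightarrow> 'a) \<Rightarrow> ('a \<Rightarrow> 'a \<Rightarrow> 'a) \<Rightarrow> 'a \<Rightarrow> 'f \<Rightarrow> 'f \<Rightarrow> bool" where
  "axis s m a \<mu> \<nu> \<longleftrightarrow>
     left_axis s m a \<mu> \<and> right_axis s m a \<nu> \<and> Lop m a \<circ> Rop m a = Rop m a \<circ> Lop m a"

definition jordan_axis ::
    "('f::field \<Rightarrow> 'a::ab_group_add \<Rightarrow> 'a) \<Rightarrow> ('a \<Rightarrow> 'a \<Rightarrow> 'a) \<Rightarrow> 'a \<Rightarrow> 'f \<Rightarrow> 'f \<Rightarrow> bool" where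
  "jordan_axis s m a \<mu> \<nu> \<longleftrightarrow>
     axis s m a \<mu> \<nu> \<and>
     joint_eigenspace s m a (\<mu>, 0) = {0} \<and> joint_eigenspace s m a (0, \<nu>) = {0}"

text \<open>
  \<open>x = u + v + w\<close> is a decomposition of \<open>x\<close> into eigenvectors of \<open>T\<close> for \<open>1\<close>, \<open>0\<close> and \<open>\<mu>\<close>,
  in this order.
\<close>

definition eigen_decomposition ::
    "('f::field \<Rightarrow> 'a::ab_group_add \<Rightarrow> 'a) \<Rightarrow> ('a \<Rightarrow> 'a) \<Rightarrow> 'f \<Rightarrow> 'a \<Rightarrow> 'a \<Rightarrow> 'a \<Rightarrow> 'a \<Rightarrow> bool" where
  "eigen_decomposition s T \<mu> x u v w \<longleftrightarrow>
     u \<in> eigenspace s T 1 \<and> v \<in> eigenspace s T 0 \<and> w \<in> eigenspace s T \<mu> \<and> x = u + v + w"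

end

theory Submission
  imports Defs
begin

text \<open>
  The cubic identity makes Lagrange polynomials in $L_a$ and $R_a$ the eigenprojections. Since
  $L_a$ and $R_a$ commute, the right projections preserve the left eigenspaces, so intersecting the
  left and right $Z_2$-gradings gives a $Z_2 \times Z_2$-grading. Its parts are sums of joint
  eigenspaces, where those with exactly one eigenvalue 1 vanish because $A_1(L_a) = Fa = A_1(R_a)$.
  In the Jordan case only the diagonal of the $Z_2 \times Z_2$-grading survives.
\<close>

section \<open>Direct sums and gradings\<close>

lemma UNIV_bit: "(UNIV :: bit set) = {0, 1}"
  by (auto intro: bit.exhaust)

text \<open>In \<open>bit\<close>, \<open>1 + 1 = 0\<close>. With \<open>x = y = b\<close> this
  places an idempotent of the minus part in the plus part as well.\<close>

lemma is_Z2_grading_minus_times_minus: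
  assumes "is_Z2_grading s m P M" "x \<in> M" "y \<in> M"
  shows "m x y \<in> P"
proof -
  define V where "V = (\<lambda>i::bit. if i = 0 then P else M)"
  have "m x y \<in> V (1 + 1)"
    using assms unfolding is_Z2_grading_def is_grading_def V_def by (metis (full_types) one_neq_zero)
  then show ?thesis
    by (simp add: V_def)
qed

context vector_space
begin

text \<open>Replaces bijectivity on extensional families by existence and independence. Restriction
  passes from \<open>Pi\<close> to \<open>Pi\<^sub>E\<close>; as the \<open>V i\<close> are
  subspaces, two families of equal sum differ by a family of sum 0.\<close>

lemma is_direct_sum_iff:
  "is_direct_sum scale I V \<longleftrightarrow>
     finite I \<and> (\<forall>i\<in>I. subspace (V i)) \<and>
     (\<forall>x. \<exists>f\<in>Pi I V. sum f I = x) \<and>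
     (\<forall>f\<in>Pi I V. sum f I = 0 \<longrightarrow> (\<forall>i\<in>I. f i = 0))"
proof (cases "finite I \<and> (\<forall>i\<in>I. subspace (V i))")
  case True
  then have sub: "\<And>i. i \<in> I \<Longrightarrow> subspace (V i)"
    by blast
  have restr: "restrict f I \<in> Pi\<^sub>E I V" "sum (restrict f I) I = sum f I" if "f \<in> Pi I V" for f
    using that by (auto intro!: sum.cong)
  have surj: "(\<lambda>f. sum f I) ` Pi\<^sub>E I V = UNIV \<longleftrightarrow> (\<forall>x. \<exists>f\<in>Pi I V. sum f I = x)"
  proof -
    have "x \<in> (\<lambda>f. sum f I) ` Pi\<^sub>E I V \<longleftrightarrow> (\<exists>f\<in>Pi I V. sum f I = x)" for x
    proof
      assume "\<exists>f\<in>Pi I V. sum f I = x"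
      then obtain f where "f \<in> Pi I V" "sum f I = x"
        by blast
      then show "x \<in> (\<lambda>f. sum f I) ` Pi\<^sub>E I V"
        using restr[of f] by (intro image_eqI[of _ _ "restrict f I"]) auto
    qed auto
    then show ?thesis
      by (simp add: set_eq_iff)
  qed
  have inj: "inj_on (\<lambda>f. sum f I) (Pi\<^sub>E I V) \<longleftrightarrow>
      (\<forall>f\<in>Pi I V. sum f I = 0 \<longrightarrow> (\<forall>i\<in>I. f i = 0))" (is "?inj \<longleftrightarrow> ?indep")
  proof
    assume inj: ?inj
    show ?indep
    proof (intro ballI impI)
      fix f i assume f: "f \<in> Pi I V" "sum f I = 0" and i: "i \<in> I"
      have z: "(\<lambda>_. 0) \<in> Pi I V"
        using sub by (auto intro: subspace_0)
      have "restrict f I = restrict (\<lambda>_. 0) I"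
        using restr[OF f(1)] restr[OF z] f(2) by (intro inj_onD[OF inj]) auto
      then show "f i = 0"
        using i by (metis restrict_apply')
    qed
  next
    assume indep: ?indep
    show ?inj
    proof (rule inj_onI)
      fix f g assume fg: "f \<in> Pi\<^sub>E I V" "g \<in> Pi\<^sub>E I V" "sum f I = sum g I"
      have "(\<lambda>i. f i - g i) \<in> Pi I V" "(\<Sum>i\<in>I. f i - g i) = 0"
        using fg sub by (auto simp: sum_subtractf intro!: subspace_diff)
      then have "\<forall>i\<in>I. f i - g i = 0"
        using indep by blast
      then show "f = g"
        using fg by (intro PiE_ext) auto
    qed
  qed
  show ?thesis
    using True surj inj by (auto simp: is_direct_sum_def bij_betw_def)
qed (auto simp: is_direct_sum_def)

text \<open>Serves two purposes: \<open>h = id\<close> discards zero summands, and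
  \<open>h i = (i, i)\<close> selects the diagonal of a grading by pairs of signs.\<close>

lemma is_direct_sum_reindex:
  assumes "is_direct_sum scale I V" "inj_on h J" "h ` J \<subseteq> I"
    and "\<And>i. i \<in> I - h ` J \<Longrightarrow> V i = {0}"
  shows "is_direct_sum scale J (\<lambda>j. V (h j))"
proof -
  note I = assms(1)[unfolded is_direct_sum_iff]
  have fin: "finite J"
    using I assms(2,3) finite_imageD finite_subset by blast
  have sum_h: "sum f I = (\<Sum>j\<in>J. f (h j))" if "\<And>i. i \<in> I - h ` J \<Longrightarrow> f i = 0" for f :: "_ \<Rightarrow> 'b"
  proof -
    have "sum f I = sum f (h ` J)"
      using I assms(3) that by (intro sum.mono_neutral_right) auto
    then show ?thesis
      by (simp add: sum.reindex[OF assms(2)])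
  qed
  have "\<exists>g\<in>Pi J (\<lambda>j. V (h j)). sum g J = x" for x
  proof -
    obtain f where f: "f \<in> Pi I V" "sum f I = x"
      using I by blast
    then have "(\<Sum>j\<in>J. f (h j)) = x"
      using assms(4) by (subst sum_h[symmetric]) (auto simp: Pi_iff)
    then show ?thesis
      using f assms(3) by (intro bexI[of _ "\<lambda>j. f (h j)"]) (auto simp: Pi_iff)
  qed
  moreover have "g j = 0" if g: "g \<in> Pi J (\<lambda>j. V (h j))" "sum g J = 0" and j: "j \<in> J" for g j
  proof -
    \<comment> \<open>Extending \<open>g\<close> by 0 off the image of \<open>h\<close> turns a zero
      sum over \<open>J\<close> into one over \<open>I\<close>, where independence is known.\<close>
    define f where "f = (\<lambda>i. if i \<in> h ` J then g (the_inv_into J h i) else 0)"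
    have fh: "f (h k) = g k" if "k \<in> J" for k
      using that by (simp add: f_def the_inv_into_f_f[OF assms(2)])
    have "f i \<in> V i" if "i \<in> I" for i
    proof (cases "i \<in> h ` J")
      case True
      then show ?thesis
        using g fh by (auto simp: Pi_iff)
    next
      case False
      then show ?thesis
        using I that by (auto simp: f_def subspace_0)
    qed
    moreover have "sum f I = 0"
      using g(2) fh by (subst sum_h) (auto simp: f_def cong: sum.cong)
    ultimately have "\<forall>i\<in>I. f i = 0"
      using I by blast
    then show ?thesis
      using fh[OF j] j assms(3) by auto
  qed
  ultimately show ?thesis
    using fin I assms(3) unfolding is_direct_sum_iff by blast
qed

text \<open>By \<open>compat\<close> each \<open>V i\<close> splits along the \<open>W j\<close>.
  Without such a condition the intersections can be too small: a plane is the sum of two lines in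
  many ways, and distinct lines meet in 0.\<close>

lemma is_direct_sum_Int:
  assumes "is_direct_sum scale I V" "is_direct_sum scale J W"
    and compat: "\<And>i x. i \<in> I \<Longrightarrow> x \<in> V i \<Longrightarrow> \<exists>g\<in>Pi J (\<lambda>j. V i \<inter> W j). sum g J = x"
  shows "is_direct_sum scale (I \<times> J) (\<lambda>(i, j). V i \<inter> W j)"
proof -
  note I = assms(1)[unfolded is_direct_sum_iff] and J = assms(2)[unfolded is_direct_sum_iff]
  have "\<exists>f\<in>Pi (I \<times> J) (\<lambda>(i, j). V i \<inter> W j). sum f (I \<times> J) = x" for x
  proof -
    obtain f where f: "f \<in> Pi I V" "sum f I = x"
      using I by blast
    have "\<forall>i\<in>I. \<exists>g. g \<in> Pi J (\<lambda>j. V i \<inter> W j) \<and> sum g J = f i"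
      using compat f(1) by (meson Pi_mem)
    then obtain g where g: "\<And>i. i \<in> I \<Longrightarrow> g i \<in> Pi J (\<lambda>j. V i \<inter> W j)"
        "\<And>i. i \<in> I \<Longrightarrow> sum (g i) J = f i"
      by metis
    have "(\<Sum>(i, j)\<in>I \<times> J. g i j) = x"
      using g(2) f(2) by (simp add: sum.cartesian_product[symmetric])
    moreover have "(\<lambda>(i, j). g i j) \<in> Pi (I \<times> J) (\<lambda>(i, j). V i \<inter> W j)"
      using g(1) by (fastforce simp: Pi_iff)
    ultimately show ?thesis
      by blast
  qed
  moreover have "f p = 0"
    if f: "f \<in> Pi (I \<times> J) (\<lambda>(i, j). V i \<inter> W j)" "sum f (I \<times> J) = 0" and p: "p \<in> I \<times> J" for f p
  proof -
    obtain i j where ij: "p = (i, j)" "i \<in> I" "j \<in> J"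
      using p by auto
    have f': "f (k, n) \<in> V k" "f (k, n) \<in> W n" if "k \<in> I" "n \<in> J" for k n
      using f(1) that by (auto simp: Pi_iff)
    \<comment> \<open>The row sums form a \<open>V\<close>-family of sum 0, so each row sum
      vanishes; a row is a \<open>W\<close>-family, so its entries vanish too.\<close>
    have "(\<lambda>k. \<Sum>n\<in>J. f (k, n)) \<in> Pi I V"
      using I f' by (auto intro!: subspace_sum)
    moreover have "(\<Sum>k\<in>I. \<Sum>n\<in>J. f (k, n)) = 0"
      using f(2) by (simp add: sum.cartesian_product)
    ultimately have "(\<Sum>n\<in>J. f (i, n)) = 0"
      using I ij(2) by blast
    moreover have "(\<lambda>n. f (i, n)) \<in> Pi J W"
      using f' ij(2) by auto
    ultimately show ?thesis
      using J ij by blast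
  qed
  ultimately show ?thesis
    using I J unfolding is_direct_sum_iff by (auto intro: subspace_inter)
qed

text \<open>Directness comes from the splitting condition. The product rule holds in each coordinate
  separately, because pairs are added componentwise.\<close>

lemma is_grading_Int:
  fixes V :: "'g::ab_group_add \<Rightarrow> 'b set" and W :: "'h::ab_group_add \<Rightarrow> 'b set"
  assumes "is_grading scale m V" "is_grading scale m W"
    and "\<And>g x. x \<in> V g \<Longrightarrow> \<exists>f\<in>Pi UNIV (\<lambda>h. V g \<inter> W h). sum f UNIV = x"
  shows "is_grading scale m (\<lambda>(g, h). V g \<inter> W h)"
  using assms is_direct_sum_Int[of UNIV V UNIV W]
  by (auto simp: is_grading_def UNIV_Times_UNIV)

end

section \<open>Operators annihilated by $(T - \mu)(T - 1)T$\<close>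

text \<open>Here \<open>T\<close> stands for L_a with \<lambda> as well as for R_a with \<delta>, so
  both decompositions are obtained at once.\<close>

locale cubic_operator = vector_space s
  for s :: "'f::field \<Rightarrow> 'a::ab_group_add \<Rightarrow> 'a" (infixr "\<cdot>" 75) +
  fixes T :: "'a \<Rightarrow> 'a" and \<mu> :: 'f
  assumes linear_T: "Vector_Spaces.linear s s T"
    and \<mu>: "\<mu> \<notin> {0, 1}"
    and cubic: "\<And>x. shift s T \<mu> (shift s T 1 (T x)) = 0"
begin

sublocale T: Vector_Spaces.linear s s T
  by (rule linear_T)

lemma subspace_eigenspace: "subspace (eigenspace s T \<nu>)"
  by (rule subspaceI) (auto simp: eigenspace_def T.add T.scale T.zero scale_right_distrib scale_left_commute)

lemma T_cubed: "T (T (T x)) = T (T x) + \<mu> \<cdot> T (T x) - \<mu> \<cdot> T x"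
  using cubic[of x]
  by (simp add: shift_def T.diff T.scale algebra_simps scale_right_diff_distrib)

text \<open>On an eigenvector for \<open>\<nu>\<close> the cubic acts as the scalar
  \<open>(\<nu> - \<mu>) * (\<nu> - 1) * \<nu>\<close>.\<close>

lemma eigenvalue_cases:
  assumes "x \<in> eigenspace s T \<nu>" "x \<noteq> 0"
  shows "\<nu> = 0 \<or> \<nu> = 1 \<or> \<nu> = \<mu>"
proof -
  have "((\<nu> - \<mu>) * (\<nu> - 1) * \<nu>) \<cdot> x = 0"
    using cubic[of x] assms(1)
    by (simp add: shift_def eigenspace_def T.diff T.scale algebra_simps scale_right_diff_distrib)
  then show ?thesis
    using assms(2) by auto
qed

text \<open>Each of the quadratics T(T - \<mu>), (T - \<mu>)(T - 1), T(T - 1) kills two of the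
  components and multiplies the third by 1 - \<mu>, \<mu> or \<mu>(\<mu> - 1) respectively. These
  constants are nonzero and are the denominators.\<close>

lemma eigen_decomposition_unique:
  assumes "eigen_decomposition s T \<mu> x u v w"
  shows "u = (1 / (1 - \<mu>)) \<cdot> T (shift s T \<mu> x)"
    and "v = (1 / \<mu>) \<cdot> shift s T \<mu> (shift s T 1 x)"
    and "w = (1 / (\<mu> * (\<mu> - 1))) \<cdot> T (shift s T 1 x)"
proof -
  have e: "T u = u" "T v = 0" "T w = \<mu> \<cdot> w" "x = u + v + w"
    using assms by (auto simp: eigen_decomposition_def eigenspace_def)
  have "T (shift s T \<mu> x) = (1 - \<mu>) \<cdot> u"
    "shift s T \<mu> (shift s T 1 x) = \<mu> \<cdot> v"
    "T (shift s T 1 x) = (\<mu> * (\<mu> - 1)) \<cdot> w"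
    by (simp_all add: shift_def e T.add T.diff T.scale T.neg T.zero algebra_simps)
  then show "u = (1 / (1 - \<mu>)) \<cdot> T (shift s T \<mu> x)"
    "v = (1 / \<mu>) \<cdot> shift s T \<mu> (shift s T 1 x)"
    "w = (1 / (\<mu> * (\<mu> - 1))) \<cdot> T (shift s T 1 x)"
    using \<mu> by simp_all
qed

text \<open>Each quadratic times its missing linear factor is the cubic, so its values are
  eigenvectors; the three Lagrange polynomials add up to 1.\<close>

lemma eigen_decomposition_projections:
  "eigen_decomposition s T \<mu> x
     ((1 / (1 - \<mu>)) \<cdot> T (shift s T \<mu> x))
     ((1 / \<mu>) \<cdot> shift s T \<mu> (shift s T 1 x))
     ((1 / (\<mu> * (\<mu> - 1))) \<cdot> T (shift s T 1 x))"
proof -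
  \<comment> \<open>All components lie in the span of \<open>x\<close>, \<open>T x\<close> and
    \<open>T (T x)\<close>, on which \<open>T_cubed\<close> determines \<open>T\<close>.\<close>
  define y z where "y = T x" and "z = T (T x)"
  have *: "T (shift s T \<mu> x) = z - \<mu> \<cdot> y"
    "shift s T \<mu> (shift s T 1 x) = z - y - \<mu> \<cdot> y + \<mu> \<cdot> x"
    "T (shift s T 1 x) = z - y"
    by (simp_all add: shift_def y_def z_def T.diff T.scale algebra_simps)
  have T: "T x = y" "T y = z" "T z = z + \<mu> \<cdot> z - \<mu> \<cdot> y"
    using T_cubed[of x] by (simp_all add: y_def z_def)
  have eigen: "z - \<mu> \<cdot> y \<in> eigenspace s T 1" "z - y - \<mu> \<cdot> y + \<mu> \<cdot> x \<in> eigenspace s T 0"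
    "z - y \<in> eigenspace s T \<mu>"
    by (simp_all add: eigenspace_def T.diff T.add T.scale T algebra_simps)
  \<comment> \<open>These are the coefficients of \<open>T (T x)\<close> and \<open>- T x\<close> in
    the sum of the three components; the coefficient of \<open>x\<close> is \<mu>/\<mu> = 1.\<close>
  have coeffs: "1 / (1 - \<mu>) + 1 / \<mu> + 1 / (\<mu> * (\<mu> - 1)) = 0"
    "\<mu> / (1 - \<mu>) + (1 + \<mu>) / \<mu> + 1 / (\<mu> * (\<mu> - 1)) = 0"
    using \<mu> by (simp_all add: divide_simps) (simp_all add: algebra_simps)
  have "(1 / (1 - \<mu>)) \<cdot> (z - \<mu> \<cdot> y) + (1 / \<mu>) \<cdot> (z - y - \<mu> \<cdot> y + \<mu> \<cdot> x)
        + (1 / (\<mu> * (\<mu> - 1))) \<cdot> (z - y)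
      = (1 / (1 - \<mu>) + 1 / \<mu> + 1 / (\<mu> * (\<mu> - 1))) \<cdot> z
        - (\<mu> / (1 - \<mu>) + (1 + \<mu>) / \<mu> + 1 / (\<mu> * (\<mu> - 1))) \<cdot> y + x"
    using \<mu> by (simp add: scale_left_distrib scale_right_distrib scale_right_diff_distrib
        add_divide_distrib)
  then have "x = (1 / (1 - \<mu>)) \<cdot> (z - \<mu> \<cdot> y) + (1 / \<mu>) \<cdot> (z - y - \<mu> \<cdot> y + \<mu> \<cdot> x)
      + (1 / (\<mu> * (\<mu> - 1))) \<cdot> (z - y)"
    unfolding coeffs by simp
  then show ?thesis
    using eigen unfolding * eigen_decomposition_def
    by (auto intro: subspace_scale[OF subspace_eigenspace])
qed

lemma eigen_decomposition_iff:
  "eigen_decomposition s T \<mu> x u v w \<longleftrightarrow>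
     u = (1 / (1 - \<mu>)) \<cdot> T (shift s T \<mu> x) \<and>
     v = (1 / \<mu>) \<cdot> shift s T \<mu> (shift s T 1 x) \<and>
     w = (1 / (\<mu> * (\<mu> - 1))) \<cdot> T (shift s T 1 x)"
  using eigen_decomposition_unique eigen_decomposition_projections by blast

text \<open>The components are polynomials in \<open>T\<close> applied to \<open>x\<close>. This is
  used for R_a on the eigenspaces of L_a and on the parts of the left grading.\<close>

lemma eigen_decomposition_in_invariant_subspace:
  assumes U: "subspace U" "\<And>y. y \<in> U \<Longrightarrow> T y \<in> U" and x: "x \<in> U"
  obtains u v w where "eigen_decomposition s T \<mu> x u v w" "u \<in> U" "v \<in> U" "w \<in> U"
proof -
  have shift: "shift s T \<nu> y \<in> U" if "y \<in> U" for y \<nu>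
    using that U by (auto simp: shift_def intro!: subspace_diff subspace_scale)
  show thesis
    by (rule that[OF eigen_decomposition_projections])
      (intro subspace_scale[OF U(1)] U(2) shift x)+
qed

text \<open>The \<mu>-component of \<open>x\<close> is 0 by the first assumption and
  \<open>x\<close> by the second; components are unique.\<close>

lemma eigenspaces_plus_Int_minus:
  assumes "x \<in> eigenspace s T 0 + eigenspace s T 1" "x \<in> eigenspace s T \<mu>"
  shows "x = 0"
proof -
  obtain v u where "x = v + u" "v \<in> eigenspace s T 0" "u \<in> eigenspace s T 1"
    using assms(1) by (auto elim: set_plus_elim)
  then have "eigen_decomposition s T \<mu> x u v 0"
    by (simp add: eigen_decomposition_def add.commute subspace_0[OF subspace_eigenspace])
  moreover have "eigen_decomposition s T \<mu> x 0 0 x"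
    using assms(2) by (simp add: eigen_decomposition_def subspace_0[OF subspace_eigenspace])
  ultimately show ?thesis
    unfolding eigen_decomposition_iff by simp
qed

end

section \<open>Axes\<close>

context nonassoc_algebra
begin

lemma linear_Lop: "Vector_Spaces.linear s s (Lop m a)"
  and linear_Rop: "Vector_Spaces.linear s s (Rop m a)"
  by (simp_all add: Lop_def Rop_def linear_left linear_right)

lemma cubic_operator_left: "left_axis s m a l \<Longrightarrow> cubic_operator s (Lop m a) l"
  and cubic_operator_right: "right_axis s m a d \<Longrightarrow> cubic_operator s (Rop m a) d"
  using linear_Lop linear_Rop vector_space_axioms
  by (auto simp: left_axis_def right_axis_def one_sided_axis_def
      cubic_operator_def cubic_operator_axioms_def)

text \<open>The projection lands in the eigenspace for 1, which is the line F a.\<close>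

lemma one_sided_axis_projection:
  assumes "one_sided_axis s m T a \<mu>" "cubic_operator s T \<mu>"
  shows "\<exists>\<alpha>. s (1 / (1 - \<mu>)) (T (shift s T \<mu> x)) = s \<alpha> a"
  using cubic_operator.eigen_decomposition_projections[OF assms(2), of x] assms(1)
  by (auto simp: eigen_decomposition_def one_sided_axis_def)

text \<open>Eigenvalue 1 would give b = c a with c^2 = c and c nonzero, hence b = a. Eigenvalue
  \<lambda> would put b = b b in both the minus and the plus part, hence b = 0. Only 0
  remains.\<close>

lemma left_eigenvector_idempotent:
  assumes a: "left_axis s m a l" and b: "m b b = b" "b \<noteq> a" "is_eigenvector s (Lop m a) b"
  shows "m a b = 0"
proof -
  interpret cubic_operator s "Lop m a" l
    by (rule cubic_operator_left[OF a])
  have ax: "one_sided_axis s m (Lop m a) a l"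
    using a by (simp add: left_axis_def)
  obtain \<nu> where \<nu>: "b \<noteq> 0" "b \<in> eigenspace s (Lop m a) \<nu>"
    using b(3) by (auto simp: is_eigenvector_def)
  consider "\<nu> = 0" | "\<nu> = 1" | "\<nu> = l"
    using eigenvalue_cases \<nu> by blast
  then show ?thesis
  proof cases
    case 1
    then show ?thesis
      using \<nu>(2) by (simp add: eigenspace_def Lop_def)
  next
    case 2
    then obtain c where c: "b = s c a"
      using \<nu>(2) ax by (auto simp: one_sided_axis_def)
    interpret R: Vector_Spaces.linear s s "\<lambda>x. m x (s c a)"
      by (rule linear_right)
    interpret L: Vector_Spaces.linear s s "m a"
      using linear_left[of a] by simp
    have "s (c * c) a = s c a"
      using b(1) ax unfolding c by (simp add: R.scale L.scale one_sided_axis_def)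
    then have "c = 1"
      using \<nu>(1) c by auto
    then show ?thesis
      using c b(2) by simp
  next
    case 3
    have "b \<in> eigenspace s (Lop m a) 0 + eigenspace s (Lop m a) 1"
      using ax is_Z2_grading_minus_times_minus[of s m _ _ b b] \<nu>(2) 3 b(1)
      unfolding one_sided_axis_def by metis
    then have "b = 0"
      using eigenspaces_plus_Int_minus \<nu>(2) 3 by blast
    then show ?thesis
      using \<nu>(1) by simp
  qed
qed

end

section \<open>Joint eigenspaces of a two-sided axis\<close>

locale two_sided_axis = nonassoc_algebra s m
  for s :: "'f::field \<Rightarrow> 'a::ab_group_add \<Rightarrow> 'a" (infixr "\<cdot>" 75) and m +
  fixes a :: 'a and l d :: 'f
  assumes axis: "axis s m a l d"
begin

lemma left_axis: "left_axis s m a l"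
  and right_axis: "right_axis s m a d"
  and commute: "Lop m a (Rop m a x) = Rop m a (Lop m a x)"
  using axis by (auto simp: axis_def fun_eq_iff)

sublocale L: cubic_operator s "Lop m a" l
  by (rule cubic_operator_left[OF left_axis])

sublocale R: cubic_operator s "Rop m a" d
  by (rule cubic_operator_right[OF right_axis])

abbreviation "EL \<equiv> eigenspace s (Lop m a)"
abbreviation "ER \<equiv> eigenspace s (Rop m a)"
abbreviation "J \<equiv> joint_eigenspace s m a"

lemma J_eq: "J (\<rho>, \<sigma>) = EL \<rho> \<inter> ER \<sigma>"
  by (simp add: joint_eigenspace_def)

text \<open>Both are the line F a. This identity links the left and right eigenspaces.\<close>

lemma EL_1_eq_ER_1: "EL 1 = ER 1"
  using left_axis right_axis by (simp add: left_axis_def right_axis_def one_sided_axis_def)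

lemma Rop_EL_1: "x \<in> EL 1 \<Longrightarrow> Rop m a x = x"
  unfolding EL_1_eq_ER_1 by (simp add: eigenspace_def)

text \<open>R_a commutes with L_a.\<close>

lemma EL_invariant: "x \<in> EL \<rho> \<Longrightarrow> Rop m a x \<in> EL \<rho>"
  by (simp add: eigenspace_def commute R.T.scale)

lemma zero_in_J: "0 \<in> J p"
  by (cases p) (simp add: J_eq subspace_0[OF L.subspace_eigenspace] subspace_0[OF R.subspace_eigenspace])

lemma eigenspace_disjoint:
  assumes "x \<in> eigenspace s T \<rho>" "x \<in> eigenspace s T \<sigma>" "\<rho> \<noteq> \<sigma>"
  shows "x = 0"
  using assms by (simp add: eigenspace_def)

text \<open>A vector of ER 1 also lies in EL 1, so it would have the two left eigenvalues
  \<open>\<rho>\<close> and 1.\<close>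

lemma J_trivial_left: "\<rho> \<noteq> 1 \<Longrightarrow> J (\<rho>, 1) = {0}"
  using zero_in_J[of "(\<rho>, 1)"] EL_1_eq_ER_1 eigenspace_disjoint by (fastforce simp: J_eq)

lemma J_trivial_right: "\<sigma> \<noteq> 1 \<Longrightarrow> J (1, \<sigma>) = {0}"
  using zero_in_J[of "(1, \<sigma>)"] EL_1_eq_ER_1 eigenspace_disjoint by (fastforce simp: J_eq)

lemma J_trivial: "J (0, 1) = {0}" "J (l, 1) = {0}" "J (1, 0) = {0}" "J (1, d) = {0}"
  using L.\<mu> R.\<mu> by (simp_all add: J_trivial_left J_trivial_right)

text \<open>Left eigenspaces are invariant under R_a, so the right components of their vectors stay
  inside them; this is the splitting condition of \<open>is_direct_sum_Int\<close>.\<close>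

lemma is_direct_sum_J_product: "is_direct_sum s ({0, 1, l} \<times> {0, 1, d}) J"
proof -
  have "is_direct_sum s ({0, 1, l} \<times> {0, 1, d}) (\<lambda>(\<rho>, \<sigma>). EL \<rho> \<inter> ER \<sigma>)"
  proof (rule is_direct_sum_Int)
    show "is_direct_sum s {0, 1, l} EL" "is_direct_sum s {0, 1, d} ER"
      using left_axis right_axis by (simp_all add: left_axis_def right_axis_def one_sided_axis_def)
  next
    fix \<rho> x assume "x \<in> EL \<rho>"
    then obtain u v w where uvw: "eigen_decomposition s (Rop m a) d x u v w"
        "u \<in> EL \<rho>" "v \<in> EL \<rho>" "w \<in> EL \<rho>"
      using R.eigen_decomposition_in_invariant_subspace[OF L.subspace_eigenspace EL_invariant]
      by blast
    \<comment> \<open>Components are indexed by their right eigenvalue; the \<open>else\<close>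
      branch is exactly \<open>\<sigma> = d\<close>, since \<open>d\<close> is neither 0 nor
      1.\<close>
    let ?f = "\<lambda>\<sigma>. if \<sigma> = 0 then v else if \<sigma> = 1 then u else w"
    have "?f \<in> Pi {0, 1, d} (\<lambda>\<sigma>. EL \<rho> \<inter> ER \<sigma>)" "sum ?f {0, 1, d} = x"
      using uvw R.\<mu> by (auto simp: eigen_decomposition_def algebra_simps)
    then show "\<exists>g\<in>Pi {0, 1, d} (\<lambda>\<sigma>. EL \<rho> \<inter> ER \<sigma>). sum g {0, 1, d} = x"
      by blast
  qed
  then show ?thesis
    by (simp add: joint_eigenspace_def)
qed

lemma is_direct_sum_J_subset:
  assumes "K \<subseteq> {0, 1, l} \<times> {0, 1, d}" "\<And>p. p \<in> {0, 1, l} \<times> {0, 1, d} - K \<Longrightarrow> J p = {0}"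
  shows "is_direct_sum s K J"
  using is_direct_sum_reindex[OF is_direct_sum_J_product, of id K] assms by simp

text \<open>Of the nine joint eigenspaces, the four with exactly one index equal to 1
  vanish.\<close>

lemma is_direct_sum_J: "is_direct_sum s {(1, 1), (0, 0), (0, d), (l, 0), (l, d)} J"
  by (intro is_direct_sum_J_subset) (auto simp: J_trivial)

section \<open>Intersections of left and right graded parts\<close>

lemma plus_Int_plus: "(EL 0 + EL 1) \<inter> (ER 0 + ER 1) = J (1, 1) + J (0, 0)"
proof (intro equalityI subsetI)
  fix x assume "x \<in> (EL 0 + EL 1) \<inter> (ER 0 + ER 1)"
  then obtain v u v' u' where x: "x = v + u" "x = v' + u'"
      and mem: "v \<in> EL 0" "u \<in> EL 1" "v' \<in> ER 0" "u' \<in> ER 1"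
    by (elim IntE set_plus_elim) blast
  have "v' = v + (u - u')"
    using x by (simp add: algebra_simps)
  moreover have "u - u' \<in> EL 1"
    using mem EL_1_eq_ER_1 subspace_diff[OF L.subspace_eigenspace] by blast
  \<comment> \<open>R_a kills \<open>v'\<close> and fixes \<open>u - u'\<close>, so R_a v lies in
    \<open>EL 1\<close>. By invariance it also lies in \<open>EL 0\<close>; hence it is 0 and
    \<open>v\<close> is in \<open>J (0, 0)\<close>.\<close>
  moreover have "Rop m a v = - (u - u')"
  proof -
    have "v = v' - (u - u')"
      using x by (simp add: algebra_simps)
    moreover have "Rop m a (u - u') = u - u'"
      using \<open>u - u' \<in> EL 1\<close> by (rule Rop_EL_1)
    moreover have "Rop m a v' = 0"
      using mem by (simp add: eigenspace_def)
    ultimately show ?thesis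
      by (simp add: R.T.diff)
  qed
  ultimately have "Rop m a v \<in> EL 1"
    using subspace_neg[OF L.subspace_eigenspace] by metis
  then have "Rop m a v = 0"
    using EL_invariant[OF mem(1)] eigenspace_disjoint by fastforce
  then have "v \<in> J (0, 0)"
    using mem by (simp add: J_eq eigenspace_def)
  moreover have "u \<in> J (1, 1)"
    using mem EL_1_eq_ER_1 by (simp add: J_eq)
  ultimately show "x \<in> J (1, 1) + J (0, 0)"
    using x by (auto simp: add.commute intro: set_plus_intro)
next
  fix x assume "x \<in> J (1, 1) + J (0, 0)"
  then show "x \<in> (EL 0 + EL 1) \<inter> (ER 0 + ER 1)"
    by (auto simp: J_eq add.commute elim!: set_plus_elim intro!: set_plus_intro)
qed

text \<open>For x = v + u, the equation R_a x = \<delta> x becomes R_a v - \<delta> v = (\<delta> -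
  1) u. The left side is in \<open>EL 0\<close> and the right side in \<open>EL 1\<close>, so both
  vanish and u = 0.\<close>

lemma plus_Int_minus: "(EL 0 + EL 1) \<inter> ER d = J (0, d)"
proof (intro equalityI subsetI)
  fix x assume "x \<in> (EL 0 + EL 1) \<inter> ER d"
  then obtain v u where x: "x = v + u" "v \<in> EL 0" "u \<in> EL 1" "x \<in> ER d"
    by (auto elim!: set_plus_elim)
  have "Rop m a v + u = d \<cdot> v + d \<cdot> u"
    using x(1,4) Rop_EL_1[OF x(3)] by (simp add: eigenspace_def R.T.add scale_right_distrib)
  then have "Rop m a v - d \<cdot> v = (d - 1) \<cdot> u"
    by (simp add: algebra_simps)
  moreover have "Rop m a v - d \<cdot> v \<in> EL 0"
    using x(2) EL_invariant subspace_diff[OF L.subspace_eigenspace]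
      subspace_scale[OF L.subspace_eigenspace] by blast
  moreover have "(d - 1) \<cdot> u \<in> EL 1"
    using x(3) subspace_scale[OF L.subspace_eigenspace] by blast
  ultimately have "(d - 1) \<cdot> u = 0"
    using eigenspace_disjoint by fastforce
  then have "u = 0"
    using R.\<mu> by simp
  then show "x \<in> J (0, d)"
    using x by (simp add: J_eq)
next
  fix x assume "x \<in> J (0, d)"
  then show "x \<in> (EL 0 + EL 1) \<inter> ER d"
    using set_plus_intro[of x "EL 0" 0 "EL 1"] subspace_0[OF L.subspace_eigenspace]
    by (simp add: J_eq)
qed

text \<open>R_a maps x = v + u to u, and it preserves \<open>EL l\<close>; so u lies in both
  \<open>EL l\<close> and \<open>EL 1\<close>.\<close>

lemma minus_Int_plus: "EL l \<inter> (ER 0 + ER 1) = J (l, 0)"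
proof (intro equalityI subsetI)
  fix x assume "x \<in> EL l \<inter> (ER 0 + ER 1)"
  then obtain v u where x: "x = v + u" "v \<in> ER 0" "u \<in> ER 1" "x \<in> EL l"
    by (auto elim!: set_plus_elim)
  have "Rop m a x = u"
    using x by (simp add: eigenspace_def R.T.add)
  then have "u \<in> EL l"
    using EL_invariant x(4) by metis
  then have "u = 0"
    using x(3) EL_1_eq_ER_1 eigenspace_disjoint L.\<mu> by blast
  then show "x \<in> J (l, 0)"
    using x by (simp add: J_eq)
next
  fix x assume "x \<in> J (l, 0)"
  then show "x \<in> EL l \<inter> (ER 0 + ER 1)"
    using set_plus_intro[of x "ER 0" 0 "ER 1"] subspace_0[OF R.subspace_eigenspace]
    by (simp add: J_eq)
qed

lemma is_Z2xZ2_grading_J: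
  "is_Z2xZ2_grading s m (J (1, 1) + J (0, 0)) (J (0, d)) (J (l, 0)) (J (l, d))"
proof -
  define V where "V = (\<lambda>i::bit. if i = 0 then EL 0 + EL 1 else EL l)"
  define W where "W = (\<lambda>i::bit. if i = 0 then ER 0 + ER 1 else ER d)"
  have V: "is_grading s m V" and W: "is_grading s m W"
    using left_axis right_axis
    by (simp_all add: V_def W_def left_axis_def right_axis_def one_sided_axis_def is_Z2_grading_def)
  have sub: "subspace (V i)" for i
    using V unfolding is_grading_def is_direct_sum_def by blast
  \<comment> \<open>Invariance of the left parts under R_a lets each of them split along the right
    grading, as \<open>is_grading_Int\<close> demands.\<close>
  have inv: "Rop m a x \<in> V i" if "x \<in> V i" for x i
  proof (cases "i = 0")
    case True
    then have "x \<in> EL 0 + EL 1"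
      using that by (simp add: V_def)
    then obtain v u where "x = v + u" "v \<in> EL 0" "u \<in> EL 1"
      by (rule set_plus_elim)
    then show ?thesis
      using True by (simp add: V_def R.T.add set_plus_intro EL_invariant)
  next
    case False
    then show ?thesis
      using that by (simp add: V_def EL_invariant)
  qed
  have "is_grading s m (\<lambda>(i, j). V i \<inter> W j)"
  proof (rule is_grading_Int[OF V W])
    fix i x assume "x \<in> V i"
    then obtain u v w where uvw: "eigen_decomposition s (Rop m a) d x u v w"
        "u \<in> V i" "v \<in> V i" "w \<in> V i"
      using R.eigen_decomposition_in_invariant_subspace[OF sub inv] by blast
    \<comment> \<open>The right plus part is \<open>ER 0 + ER 1\<close>, so it receives the
      components for 0 and 1 together.\<close>
    let ?f = "\<lambda>j::bit. if j = 0 then v + u else w"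
    have "v + u \<in> V i" "v + u \<in> W 0" "w \<in> W 1"
      using uvw subspace_add[OF sub] set_plus_intro
      by (auto simp: eigen_decomposition_def W_def)
    then have "?f \<in> Pi UNIV (\<lambda>j. V i \<inter> W j)"
      using uvw(4) by (simp add: Pi_iff W_def)
    moreover have "sum ?f UNIV = x"
      using uvw(1) by (simp add: eigen_decomposition_def UNIV_bit add.commute)
    ultimately show "\<exists>f\<in>Pi UNIV (\<lambda>j. V i \<inter> W j). sum f UNIV = x"
      by (intro bexI[of _ ?f])
  qed
  \<comment> \<open>Three parts are the intersections computed above; the fourth,
    \<open>EL l \<inter> ER d\<close>, is \<open>J (l, d)\<close> by definition.\<close>
  moreover have "(\<lambda>(i, j). V i \<inter> W j) = (\<lambda>(i, j).
      if i = 0 then (if j = 0 then J (1, 1) + J (0, 0) else J (0, d))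
      else (if j = 0 then J (l, 0) else J (l, d)))"
    by (rule ext) (simp add: V_def W_def plus_Int_plus plus_Int_minus minus_Int_plus
        J_eq[symmetric] split: prod.split)
  ultimately show ?thesis
    by (simp add: is_Z2xZ2_grading_def)
qed

text \<open>The two assumptions say that the +- and -+ parts vanish. The grading then lives on the
  diagonal subgroup, a copy of the sign group.\<close>

lemma jordan_gradings:
  assumes "J (l, 0) = {0}" "J (0, d) = {0}"
  shows "is_direct_sum s {(1, 1), (0, 0), (l, d)} J"
    and "is_Z2_grading s m (J (1, 1) + J (0, 0)) (J (l, d))"
proof -
  show "is_direct_sum s {(1, 1), (0, 0), (l, d)} J"
  proof (rule is_direct_sum_J_subset)
    fix p assume "p \<in> {0, 1, l} \<times> {0, 1, d} - {(1, 1), (0, 0), (l, d)}"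
    then consider "p = (0, 1)" | "p = (l, 1)" | "p = (1, 0)" | "p = (1, d)" | "p = (l, 0)" | "p = (0, d)"
      by blast
    then show "J p = {0}"
      by cases (simp_all only: assms J_trivial)
  qed auto
  define G where "G = (\<lambda>(i::bit, j::bit).
      if i = 0 then (if j = 0 then J (1, 1) + J (0, 0) else J (0, d))
      else (if j = 0 then J (l, 0) else J (l, d)))"
  have G: "is_grading s m G"
    using is_Z2xZ2_grading_J unfolding is_Z2xZ2_grading_def G_def .
  have G_off_diagonal: "G (0, 1) = {0}" "G (1, 0) = {0}"
    by (simp_all add: G_def assms)
  have "is_direct_sum s UNIV (\<lambda>i. G (i, i))"
  proof (rule is_direct_sum_reindex[where h = "\<lambda>i. (i, i)"])
    show "is_direct_sum s UNIV G"
      using G unfolding is_grading_def by blast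
    show "inj (\<lambda>i::bit. (i, i))"
      by (rule injI) blast
    fix p :: "bit \<times> bit" assume p: "p \<in> UNIV - range (\<lambda>i. (i, i))"
    obtain i j where ij: "p = (i, j)"
      by (rule prod.exhaust)
    with p have "i \<noteq> j"
      by blast
    then show "G p = {0}"
      unfolding ij by (cases i; cases j) (simp_all add: G_off_diagonal)
  qed blast
  \<comment> \<open>The diagonal is closed under addition:
    \<open>(i, i) + (j, j) = (i + j, i + j)\<close>.\<close>
  moreover have "m x y \<in> G (i + j, i + j)" if "x \<in> G (i, i)" "y \<in> G (j, j)" for i j x y
  proof -
    have "m x y \<in> G ((i, i) + (j, j))"
      using G that unfolding is_grading_def by blast
    then show ?thesis
      by (simp only: add_Pair)
  qed
  ultimately have "is_grading s m (\<lambda>i. G (i, i))"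
    unfolding is_grading_def by blast
  moreover have "(\<lambda>i. G (i, i)) = (\<lambda>i. if i = 0 then J (1, 1) + J (0, 0) else J (l, d))"
    by (simp add: G_def fun_eq_iff)
  ultimately show "is_Z2_grading s m (J (1, 1) + J (0, 0)) (J (l, d))"
    by (simp add: is_Z2_grading_def)
qed

end

theorem proposition3p4:
  fixes s :: "'f::field \<Rightarrow> 'a::ab_group_add \<Rightarrow> 'a" (infixr "\<cdot>" 75)
    and m :: "'a \<Rightarrow> 'a \<Rightarrow> 'a"
    and l d :: 'f and a :: 'a
  assumes "nonassoc_algebra s m"
    and "CHAR('f) \<noteq> 2"
    and "l \<notin> {0, 1}" and "d \<notin> {0, 1}"
  shows
    "(left_axis s m a l \<longrightarrow>
       (\<forall>x u v w. eigen_decomposition s (Lop m a) l x u v w \<longleftrightarrow>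
          u = (1 / (1 - l)) \<cdot> Lop m a (shift s (Lop m a) l x) \<and>
          v = (1 / l) \<cdot> shift s (Lop m a) l (shift s (Lop m a) 1 x) \<and>
          w = (1 / (l * (l - 1))) \<cdot> Lop m a (shift s (Lop m a) 1 x)) \<and>
       (\<forall>x. \<exists>\<alpha>. (1 / (1 - l)) \<cdot> Lop m a (shift s (Lop m a) l x) = \<alpha> \<cdot> a))
     \<and>
     (left_axis s m a l \<and> right_axis s m a d \<longrightarrow>
       (\<forall>x x1 x0 xl. eigen_decomposition s (Lop m a) l x x1 x0 xl \<longrightarrow>
         (\<forall>y\<in>{x0, x1, xl}.
           (\<forall>u v w. eigen_decomposition s (Rop m a) d y u v w \<longleftrightarrow>
              u = (1 / (1 - d)) \<cdot> Rop m a (shift s (Rop m a) d y) \<and>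
              v = (1 / d) \<cdot> shift s (Rop m a) d (shift s (Rop m a) 1 y) \<and>
              w = (1 / (d * (d - 1))) \<cdot> Rop m a (shift s (Rop m a) 1 y)) \<and>
           (\<exists>\<alpha>. (1 / (1 - d)) \<cdot> Rop m a (shift s (Rop m a) d y) = \<alpha> \<cdot> a))))
     \<and>
     (left_axis s m a l \<longrightarrow>
       (\<forall>b. m b b = b \<and> b \<noteq> a \<and> is_eigenvector s (Lop m a) b \<longrightarrow> m a b = 0))
     \<and>
     (axis s m a l d \<longrightarrow>
       is_direct_sum s {(1, 1), (0, 0), (0, d), (l, 0), (l, d)} (joint_eigenspace s m a) \<and>
       is_Z2xZ2_grading s m
         (joint_eigenspace s m a (1, 1) + joint_eigenspace s m a (0, 0))
         (joint_eigenspace s m a (0, d))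
         (joint_eigenspace s m a (l, 0))
         (joint_eigenspace s m a (l, d)) \<and>
       joint_eigenspace s m a (0, 1) = {0} \<and> joint_eigenspace s m a (l, 1) = {0} \<and>
       joint_eigenspace s m a (1, 0) = {0} \<and> joint_eigenspace s m a (1, d) = {0})
     \<and>
     (jordan_axis s m a l d \<longrightarrow>
       is_direct_sum s {(1, 1), (0, 0), (l, d)} (joint_eigenspace s m a) \<and>
       is_Z2_grading s m
         (joint_eigenspace s m a (1, 1) + joint_eigenspace s m a (0, 0))
         (joint_eigenspace s m a (l, d)))"
proof -
  interpret nonassoc_algebra s m
    by (rule assms(1))
  note left = cubic_operator_left[of a l] and right = cubic_operator_right[of a d]
  have left_projection: "\<exists>\<alpha>. (1 / (1 - l)) \<cdot> Lop m a (shift s (Lop m a) l x) = \<alpha> \<cdot> a"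
    if "left_axis s m a l" for x
    using that left one_sided_axis_projection[of "Lop m a" a l] by (simp add: left_axis_def)
  have right_projection: "\<exists>\<alpha>. (1 / (1 - d)) \<cdot> Rop m a (shift s (Rop m a) d x) = \<alpha> \<cdot> a"
    if "right_axis s m a d" for x
    using that right one_sided_axis_projection[of "Rop m a" a d] by (simp add: right_axis_def)
  have two_sided: "two_sided_axis s m a l d" if "axis s m a l d"
    using that nonassoc_algebra_axioms by (simp add: two_sided_axis_def two_sided_axis_axioms_def)
  have jordan: "axis s m a l d" "joint_eigenspace s m a (l, 0) = {0}"
    "joint_eigenspace s m a (0, d) = {0}" if "jordan_axis s m a l d"
    using that by (auto simp: jordan_axis_def)
  show ?thesis
    \<comment> \<open>The goals follow the order of the claims: two for (i), one each for (ii) and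
      (iii), six for (iv), two for (v). For (ii), the right-hand formulas for arbitrary vectors are
      applied to the left components.\<close>
    apply (intro conjI impI)
    subgoal by (simp add: cubic_operator.eigen_decomposition_iff[OF left])
    subgoal by (simp add: left_projection)
    subgoal by (simp add: cubic_operator.eigen_decomposition_iff[OF right] right_projection)
    subgoal by (metis left_eigenvector_idempotent)
    subgoal by (rule two_sided_axis.is_direct_sum_J[OF two_sided])
    subgoal by (rule two_sided_axis.is_Z2xZ2_grading_J[OF two_sided])
    subgoal by (rule two_sided_axis.J_trivial(1)[OF two_sided])
    subgoal by (rule two_sided_axis.J_trivial(2)[OF two_sided])
    subgoal by (rule two_sided_axis.J_trivial(3)[OF two_sided])
    subgoal by (rule two_sided_axis.J_trivial(4)[OF two_sided])
    subgoal by (rule two_sided_axis.jordan_gradings(1)[OF two_sided[OF jordan(1)] jordan(2,3)])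
    subgoal by (rule two_sided_axis.jordan_gradings(2)[OF two_sided[OF jordan(1)] jordan(2,3)])
    done
qed

end
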